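(* For every integer $k\ge 2$ there exists a mixing coded system $S$ such that every generator $\mathcal{W}$ of $S$ satisfies $\gcd\{|w|: w\in\mathcal{W}\}\ge k$.
   Context: Let $A$ be a finite alphabet and give $A^{\mathbb{Z}}$ the product topology of the discrete topology on $A$. The shift map is $\sigma((a_i)_{i\in\mathbb{Z}})=(a_{i+1})_{i\in\mathbb{Z}}$. A subshift is a nonempty closed $\sigma$-invariant subset $S\subseteq A^{\mathbb{Z}}$, with $\sigma$ restricted to it. Its language $\mathcal{L}(S)$ is the set of finite words occurring as consecutive entries in some point of $S$. Coded system: a subshift $S$ (over some finite alphabet $A$) is coded if there is a countable set $\mathcal{W}$ of (nonempty) finite words over $A$, called a generator of $S$, such that $S$ is the closure of the set of all bi-infinite sequences obtained by concatenating elements of $\mathcal{W}$ in arbitrary order (with arbitrary position of the origin). Equivalently, $\mathcal{L}(S)$ is the set of all subwords of finite concatenations of elements of $\mathcal{W}$. Here $|w|$ denotes the length of the word $w$. A coded system may have many generators. Mixing: $S$ is mixing if for all nonempty open sets $U,V\subseteq S$ the set $N(U,V)=\{n\in\mathbb{Z}: U\cap\sigma^{-n}V\neq\emptyset\}$ is cofinite. *)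

theory Defs
  imports "HOL-Analysis.Analysis"
begin

definition full_shift :: "'a set \<Rightarrow> (int \<Rightarrow> 'a) topology" where
  "full_shift A = product_topology (\<lambda>_. discrete_topology A) UNIV"

(* The integer power sigma^n of the shift map sigma = shift_pow 1. *)
definition shift_pow :: "int \<Rightarrow> (int \<Rightarrow> 'a) \<Rightarrow> (int \<Rightarrow> 'a)" where
  "shift_pow n x = (\<lambda>i. x (i + n))"

abbreviation shift :: "(int \<Rightarrow> 'a) \<Rightarrow> (int \<Rightarrow> 'a)" where
  "shift \<equiv> shift_pow 1"

lemma shift_pow_0: "shift_pow 0 = id"
  by (simp add: shift_pow_def fun_eq_iff)

lemma shift_pow_add: "shift_pow (m + n) = shift_pow m \<circ> shift_pow n"
  by (simp add: shift_pow_def fun_eq_iff add.assoc)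

definition subshift :: "'a set \<Rightarrow> (int \<Rightarrow> 'a) set \<Rightarrow> bool" where
  "subshift A S \<longleftrightarrow> finite A \<and> S \<noteq> {} \<and> closedin (full_shift A) S \<and> shift ` S = S"

(* The j-th word w j occupies the positions p j, ..., p (j + 1) - 1 of x.  If all words of W
   are nonempty, these blocks cover all of the integers; the value p 0 is the free choice of
   the origin. *)
definition concatenation :: "'a list set \<Rightarrow> (int \<Rightarrow> 'a) \<Rightarrow> bool" where
  "concatenation W x \<longleftrightarrow>
     (\<exists>(w :: int \<Rightarrow> 'a list) (p :: int \<Rightarrow> int). \<forall>j.
        w j \<in> W \<and> p (j + 1) = p j + int (length (w j)) \<and>
        (\<forall>i < length (w j). x (p j + int i) = w j ! i))"

definition generator :: "'a set \<Rightarrow> (int \<Rightarrow> 'a) set \<Rightarrow> 'a list set \<Rightarrow> bool" where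
  "generator A S W \<longleftrightarrow> countable W \<and> W \<subseteq> lists A \<and> [] \<notin> W \<and>
     S = full_shift A closure_of {x. concatenation W x}"

definition coded_system :: "'a set \<Rightarrow> (int \<Rightarrow> 'a) set \<Rightarrow> bool" where
  "coded_system A S \<longleftrightarrow> subshift A S \<and> (\<exists>W. generator A S W)"

definition hitting_times :: "(int \<Rightarrow> 'a) set \<Rightarrow> (int \<Rightarrow> 'a) set \<Rightarrow> int set" where
  "hitting_times U V = {n. U \<inter> shift_pow n -` V \<noteq> {}}"

definition mixing :: "'a set \<Rightarrow> (int \<Rightarrow> 'a) set \<Rightarrow> bool" where
  "mixing A S \<longleftrightarrow>
     (\<forall>U V. openin (subtopology (full_shift A) S) U \<and> U \<noteq> {} \<and>
            openin (subtopology (full_shift A) S) V \<and> V \<noteq> {} \<longrightarrow>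
            finite (- hitting_times U V))"

end

theory Submission imports Defs "HOL-Library.Sublist" begin

text \<open>Over the letters \<open>0, \<dots>, k - 1\<close>, insert a word \<open>c\<close> after a letter \<open>0\<close> inside a long
  stretch of the periodic sequence \<open>i mod k\<close>, with at least \<open>k |c|\<close> letters on both sides, and
  iterate this together with concatenation.  The blocks obtained have length divisible by \<open>k\<close>,
  but each insertion moves \<open>c\<close> by one position modulo \<open>k\<close>, so every word occurs in every
  phase; since \<open>0 1 \<dots> (k - 1)\<close> is a block, the coded system is mixing.

  Give the letter \<open>0\<close> weight \<open>k - 1\<close> and all others weight \<open>-1\<close>, so that blocks are balanced.
  If \<open>m\<close> is not divisible by \<open>k\<close>, an \<open>m\<close>-periodic word contains no stretch of \<open>i mod k\<close> longer
  than \<open>m\<close>, hence sees only insertions of short words, and its weight is bounded.  The weight of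
  \<open>u\<^sup>N\<close> is linear in \<open>N\<close>, so a point \<open>u\<^sup>\<infinity>\<close> of period \<open>m\<close> forces \<open>u\<close> to be balanced, and then
  \<open>k\<close> divides \<open>m\<close> after all.  Every word \<open>w\<close> of a generator gives the periodic point
  \<open>w\<^sup>\<infinity>\<close>, so \<open>k\<close> divides its length.\<close>

section \<open>Ramps, wraps and code words\<close>

definition ramp :: "nat \<Rightarrow> nat \<Rightarrow> nat \<Rightarrow> nat list" where
  "ramp k a b = map (\<lambda>i. i mod k) [a..<b]"

text \<open>For positive \<open>k\<close>, cutting out \<open>c\<close> leaves a single ramp of
  length \<open>k * (2 * length c + 1)\<close>. The first part has length 1 modulo \<open>k\<close>,
  which is what moves the phase of \<open>c\<close>.\<close>

definition wrap :: "nat \<Rightarrow> nat list \<Rightarrow> nat list" where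
  "wrap k c = ramp k 0 (k * length c + 1) @ c @ ramp k 1 (k * (length c + 1))"

text \<open>The smallest set containing \<open>[]\<close> and closed under concatenation and
  \<open>wrap k\<close>. Splitting off the leftmost wrap suits the prefix bounds in
  \<open>controlled\<close>.\<close>

inductive_set code :: "nat \<Rightarrow> nat list set" for k where
  Nil: "[] \<in> code k"
| Wrap: "c \<in> code k \<Longrightarrow> d \<in> code k \<Longrightarrow> wrap k c @ d \<in> code k"

definition lang :: "nat \<Rightarrow> nat list set" where
  "lang k = {v. \<exists>c \<in> code k. sublist v c}"

definition window :: "(int \<Rightarrow> 'a) \<Rightarrow> int \<Rightarrow> nat \<Rightarrow> 'a list" where
  "window x a n = map (\<lambda>i. x (a + int i)) [0..<n]"

definition weight :: "nat \<Rightarrow> nat list \<Rightarrow> int" where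
  "weight k v = int k * int (count_list v 0) - int (length v)"

text \<open>Vacuous for words of length at most \<open>m\<close>, so weight bounds for periodic
  words have to cover all of these.\<close>

definition periodic :: "nat \<Rightarrow> 'a list \<Rightarrow> bool" where
  "periodic m v \<longleftrightarrow> (\<forall>i. i + m < length v \<longrightarrow> v ! (i + m) = v ! i)"

lemma code_append: "c \<in> code k \<Longrightarrow> d \<in> code k \<Longrightarrow> c @ d \<in> code k"
  by (induction rule: code.induct) (auto intro: code.intros)

lemma wrap_in_code: "c \<in> code k \<Longrightarrow> wrap k c \<in> code k"
  using code.Wrap[OF _ code.Nil] by fastforce

lemma length_ramp [simp]: "length (ramp k a b) = b - a"
  by (simp add: ramp_def)

lemma wrap_Nil: "k > 0 \<Longrightarrow> wrap k [] = [0..<k]"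
  by (auto simp: wrap_def ramp_def upt_conv_Cons intro!: map_idI)

lemma wrap_not_Nil: "wrap k c \<noteq> []"
  by (simp add: wrap_def ramp_def)

lemma code_in_lists: "c \<in> code k \<Longrightarrow> k > 0 \<Longrightarrow> c \<in> lists {0..<k}"
  by (induction rule: code.induct) (auto simp: wrap_def ramp_def)

section \<open>Balance of code words\<close>

lemma weight_append: "weight k (u @ v) = weight k u + weight k v"
  by (simp add: weight_def algebra_simps)

lemma weight_le: "k > 0 \<Longrightarrow> \<bar>weight k v\<bar> \<le> int k * int (length v)"
proof -
  assume "k > 0"
  have "int k * int (count_list v 0) \<le> int k * int (length v)"
    by (simp add: count_le_length mult_left_mono)
  moreover have "int (length v) \<le> int k * int (length v)"
    using \<open>k > 0\<close> by (simp add: mult_le_cancel_right1)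
  moreover have "0 \<le> int k * int (count_list v 0)" by simp
  ultimately show ?thesis unfolding weight_def by linarith
qed

lemma ramp_append: "a \<le> b \<Longrightarrow> b \<le> c \<Longrightarrow> ramp k a c = ramp k a b @ ramp k b c"
  unfolding ramp_def by (metis map_append le_add_diff_inverse upt_add_eq_append)

text \<open>Exactly one of the \<open>k\<close> letters of a period is 0.\<close>

lemma weight_ramp: 
  assumes "k > 0" shows "weight k (ramp k 0 (k * n)) = 0"
proof (induction n)
  case 0
  then show ?case by (simp add: weight_def ramp_def)
next
  case (Suc n)
  have "ramp k (k * n) (k * n + k) = [0..<k]"
    by (auto simp: ramp_def intro!: nth_equalityI)
  moreover have "weight k [0..<k] = 0"
    using assms by (simp add: weight_def upt_conv_Cons count_list_0_iff)
  ultimately show ?case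
    using Suc ramp_append[of 0 "k * n" "k * n + k" k]
    by (simp add: weight_append add.commute)
qed

text \<open>The 0 at the end of the first ramp completes the second ramp to full periods, so the
  weights outside \<open>c\<close> cancel.\<close>

lemma weight_wrap:
  assumes "k > 0" "weight k c = 0" shows "weight k (wrap k c) = 0"
proof -
  let ?n = "length c"
  have 1: "weight k (ramp k 0 (k * ?n + 1)) = weight k [0]"
    using weight_ramp[OF assms(1)] ramp_append[of 0 "k * ?n" "k * ?n + 1" k]
    by (simp add: weight_append) (simp add: ramp_def)
  have "ramp k 0 (k * (?n + 1)) = [0] @ ramp k 1 (k * (?n + 1))"
    using assms(1) ramp_append[of 0 1 "k * (?n + 1)" k] by (simp add: ramp_def)
  with weight_ramp[OF assms(1), of "?n + 1"]
  have "weight k [0] + weight k (ramp k 1 (k * (?n + 1))) = 0"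
    by (metis weight_append)
  with 1 assms(2) show ?thesis by (simp add: wrap_def weight_append)
qed

lemma weight_code: "c \<in> code k \<Longrightarrow> k > 0 \<Longrightarrow> weight k c = 0"
  by (induction rule: code.induct) (auto simp: weight_append weight_wrap, simp add: weight_def)

section \<open>Weights of periodic words\<close>

lemma periodic_sublist: "sublist u v \<Longrightarrow> periodic m v \<Longrightarrow> periodic m u"
proof -
  assume "sublist u v" and per: "periodic m v"
  then obtain p s where v: "v = p @ u @ s" by (auto simp: sublist_def)
  show "periodic m u" unfolding periodic_def
  proof (intro allI impI)
    fix i assume i: "i + m < length u"
    have "v ! (length p + i + m) = v ! (length p + i)"
      using per i by (simp add: periodic_def v)
    then show "u ! (i + m) = u ! i"
      using i by (simp add: v nth_append add.assoc)
  qed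
qed

text \<open>A longer word would have equal letters at distance \<open>m\<close>, but letters of a
  ramp agree only at positions congruent modulo \<open>k\<close>.\<close>

lemma periodic_sublist_ramp:
  assumes "sublist v (ramp k a b)" "periodic m v" "\<not> k dvd m"
  shows "length v \<le> m"
proof (rule ccontr)
  assume len: "\<not> length v \<le> m"
  obtain p s where r: "ramp k a b = p @ v @ s" using assms(1) by (auto simp: sublist_def)
  have l: "b - a = length p + length v + length s"
    using arg_cong[OF r, of length] by simp
  have n: "v ! i = (a + length p + i) mod k" if "i < length v" for i
  proof -
    have "v ! i = ramp k a b ! (length p + i)" using that by (simp add: r nth_append)
    also have "\<dots> = (a + length p + i) mod k" using that l by (simp add: ramp_def add.assoc)
    finally show ?thesis .
  qed
  have "v ! (0 + m) = v ! 0" using assms(2)[unfolded periodic_def, rule_format, of 0] len by simp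
  then have "(a + length p + m) mod k = (a + length p) mod k"
    using n[of m] n[of 0] len by (cases v) simp_all
  then have "k dvd m"
    by (metis add_diff_cancel_left' mod_eq_dvd_iff_nat le_add1)
  with assms(3) show False ..
qed

text \<open>The pieces into which code words are cut: long ramps, which are not
  \<^term>\<open>m\<close>-periodic, and wraps of short words, which are balanced.\<close>
definition piece :: "nat \<Rightarrow> nat \<Rightarrow> int \<Rightarrow> nat list \<Rightarrow> bool" where
  "piece k m B b \<longleftrightarrow> (periodic m b \<longrightarrow> weight k b = 0) \<and>
     (\<forall>v. sublist v b \<longrightarrow> periodic m v \<longrightarrow> \<bar>weight k v\<bar> \<le> B)"

text \<open>The sharper bound on prefixes is the one that must not grow when pieces are prepended;
  the bound on factors follows by splitting at a border.\<close>

definition controlled :: "nat \<Rightarrow> nat \<Rightarrow> int \<Rightarrow> nat list \<Rightarrow> bool" where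
  "controlled k m B z \<longleftrightarrow>
     (\<forall>v. prefix v z \<longrightarrow> periodic m v \<longrightarrow> \<bar>weight k v\<bar> \<le> B) \<and>
     (\<forall>v. sublist v z \<longrightarrow> periodic m v \<longrightarrow> \<bar>weight k v\<bar> \<le> 2 * B)"

text \<open>A periodic prefix that reaches beyond \<open>b\<close> contains all of \<open>b\<close>,
  which is then periodic itself and contributes 0. A factor across the border is a suffix of
  \<open>b\<close> and a prefix of \<open>z\<close>, each contributing at most
  \<open>B\<close>.\<close>

lemma controlled_piece_append:
  assumes b: "piece k m B b" and z: "controlled k m B z" and B: "B \<ge> 0"
  shows "controlled k m B (b @ z)"
  unfolding controlled_def
proof (intro conjI allI impI)
  fix v assume v: "prefix v (b @ z)" "periodic m v"
  then consider "prefix v b" | us where "v = b @ us" "prefix us z"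
    by (auto simp: prefix_append)
  then show "\<bar>weight k v\<bar> \<le> B"
  proof cases
    case 1 with b v show ?thesis by (auto simp: piece_def)
  next
    case 2
    then have "periodic m b" "periodic m us"
      using periodic_sublist[OF _ v(2)] by (auto simp: sublist_appendI)
    with 2 b z show ?thesis by (auto simp: piece_def controlled_def weight_append)
  qed
next
  fix v assume v: "sublist v (b @ z)" "periodic m v"
  then consider "sublist v b" | "sublist v z" |
      xs us where "v = xs @ us" "suffix xs b" "prefix us z"
    by (auto simp: sublist_append)
  then show "\<bar>weight k v\<bar> \<le> 2 * B"
  proof cases
    case 1 with b v B show ?thesis by (force simp: piece_def)
  next
    case 2 with z v show ?thesis by (auto simp: controlled_def)
  next
    case 3
    then have "periodic m xs" "periodic m us"
      using periodic_sublist[OF _ v(2)] by (auto simp: sublist_appendI)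
    with 3 b z have "\<bar>weight k xs\<bar> \<le> B" "\<bar>weight k us\<bar> \<le> B"
      by (auto simp: piece_def controlled_def)
    with 3 show ?thesis by (simp add: weight_append)
  qed
qed

text \<open>The second factor is the length of \<open>wrap k c\<close> for \<open>c\<close> of
  length \<open>m\<close>; the first bounds the weight of a letter.\<close>

definition bound :: "nat \<Rightarrow> nat \<Rightarrow> int" where
  "bound k m = int k * int ((2 * k + 1) * m + k)"

lemma piece_short:
  assumes "k > 0" "weight k b = 0" "length b \<le> (2 * k + 1) * m + k"
  shows "piece k m (bound k m) b"
  unfolding piece_def
proof (intro conjI allI impI)
  fix v assume "sublist v b"
  then have "length v \<le> (2 * k + 1) * m + k"
    using assms(3) sublist_length_le by fastforce
  then have "int k * int (length v) \<le> bound k m"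
    unfolding bound_def by (intro mult_left_mono) (simp_all only: of_nat_le_iff of_nat_0_le_iff)
  then show "\<bar>weight k v\<bar> \<le> bound k m" using weight_le[OF assms(1), of v] by linarith
qed (use assms(2) in simp)

text \<open>Such a ramp is too long to be periodic, and its periodic factors have length at most
  \<open>m\<close>.\<close>

lemma piece_ramp:
  assumes "k > 0" "\<not> k dvd m" "b - a > m"
  shows "piece k m (bound k m) (ramp k a b)"
  unfolding piece_def
proof (intro conjI allI impI)
  assume "periodic m (ramp k a b)"
  from periodic_sublist_ramp[OF _ this assms(2)] assms(3)
  show "weight k (ramp k a b) = 0" by fastforce
next
  fix v assume "sublist v (ramp k a b)" "periodic m v"
  then have "length v \<le> m" using periodic_sublist_ramp assms(2) by blast
  then have "length v \<le> (2 * k + 1) * m + k" by simp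
  then have "int k * int (length v) \<le> bound k m"
    unfolding bound_def by (intro mult_left_mono) (simp_all only: of_nat_le_iff of_nat_0_le_iff)
  then show "\<bar>weight k v\<bar> \<le> bound k m" using weight_le[OF assms(1), of v] by linarith
qed

text \<open>The continuation \<open>z\<close> is arbitrary because the induction hypothesis for the
  inner word \<open>c\<close> is applied with everything to the right of \<open>c\<close> as
  continuation.\<close>

lemma controlled_code_append:
  assumes "k \<ge> 2" "\<not> k dvd m" "c \<in> code k" "controlled k m (bound k m) z"
  shows "controlled k m (bound k m) (c @ z)"
  using assms(3,4)
proof (induction arbitrary: z rule: code.induct)
  case Nil
  then show ?case by simp
next
  case (Wrap c d)
  have B: "bound k m \<ge> 0" by (simp add: bound_def)
  have k: "k > 0" using assms(1) by simp
  have dz: "controlled k m (bound k m) (d @ z)" using Wrap by blast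
  show ?case
  proof (cases "length c \<le> m")
    \<comment> \<open>The wrap of a short word is a single piece.\<close>
    case True
    have "length (wrap k c) = (2 * k + 1) * length c + k"
      using k by (simp add: wrap_def algebra_simps)
    also have "\<dots> \<le> (2 * k + 1) * m + k"
      using True by (intro add_mono mult_left_mono) auto
    finally have "piece k m (bound k m) (wrap k c)"
      using piece_short k weight_wrap weight_code Wrap.hyps(1) by blast
    from controlled_piece_append[OF this dz B] show ?thesis by simp
  next
    \<comment> \<open>Around a long word both ramps are longer than \<open>m\<close>, so they are
      pieces and only \<open>c\<close> between them needs the induction hypothesis.\<close>
    case False
    have "k * length c \<ge> 1 * length c" using k by (intro mult_right_mono) auto
    moreover have "k * (length c + 1) = k * length c + k" by simp
    ultimately have "m < k * length c + 1 - 0" "m < k * (length c + 1) - 1"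
      using False assms(1) by linarith+
    note p = this[THEN piece_ramp[OF k assms(2)]]
    show ?thesis
      using controlled_piece_append[OF p(1) Wrap.IH(1)[OF controlled_piece_append[OF p(2) dz B]] B]
      by (simp add: wrap_def)
  qed
qed

lemma weight_periodic_lang:
  assumes "k \<ge> 2" "\<not> k dvd m" "v \<in> lang k" "periodic m v"
  shows "\<bar>weight k v\<bar> \<le> 2 * bound k m"
proof -
  have "bound k m \<ge> 0" by (simp add: bound_def)
  then have "controlled k m (bound k m) []"
    by (auto simp: controlled_def weight_def)
  moreover obtain c where "c \<in> code k" "sublist v c" using assms(3) by (auto simp: lang_def)
  ultimately show ?thesis
    using controlled_code_append[OF assms(1,2), of c "[]"] assms(4) by (auto simp: controlled_def)
qed

section \<open>Windows of bi-infinite sequences\<close>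

lemma length_window [simp]: "length (window x a n) = n"
  by (simp add: window_def)

lemma nth_window [simp]: "i < n \<Longrightarrow> window x a n ! i = x (a + int i)"
  by (simp add: window_def)

lemma window_append: "window x a (m + n) = window x a m @ window x (a + int m) n"
  by (rule nth_equalityI) (auto simp: nth_append)

lemma window_eqI:
  "length v = n \<Longrightarrow> (\<And>i. i < n \<Longrightarrow> x (a + int i) = v ! i) \<Longrightarrow> window x a n = v"
  by (rule nth_equalityI) auto

lemma sublist_window:
  assumes "a \<le> b" "b + int n \<le> a + int q"
  shows "sublist (window x b n) (window x a q)"
proof -
  obtain i where b: "b = a + int i" using assms(1) by (metis zle_iff_zadd)
  then obtain j where "q = i + (n + j)"
    using assms(2) by (metis add.assoc le_iff_add nat_int_comparison(3) of_nat_add add_le_cancel_left)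
  then show ?thesis by (simp add: window_append b sublist_appendI)
qed

section \<open>The shift space and concatenations of wraps\<close>

text \<open>Given by its language; \<open>closure_eq_ramp_shift\<close> identifies it as the coded
  system generated by all wraps of code words.\<close>

definition ramp_shift :: "nat \<Rightarrow> (int \<Rightarrow> nat) set" where
  "ramp_shift k = {x. \<forall>a n. window x a n \<in> lang k}"

lemma ramp_shift_in_alphabet:
  assumes "x \<in> ramp_shift k" "k > 0" shows "x i \<in> {0..<k}"
proof -
  have "window x i 1 \<in> lang k" using assms(1) by (simp add: ramp_shift_def)
  then obtain c where "c \<in> code k" "sublist [x i] c"
    by (auto simp: lang_def window_def)
  then have "x i \<in> set c" by (auto dest: set_mono_sublist)
  with code_in_lists[OF \<open>c \<in> code k\<close> assms(2)] show ?thesis by auto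
qed

lemma window_concatenation_in_lang:
  assumes "concatenation (wrap k ` code k) x"
  shows "window x a n \<in> lang k"
proof -
  obtain w p where "\<forall>j :: int. w j \<in> wrap k ` code k \<and> p (j + 1) = p j + int (length (w j)) \<and>
      (\<forall>i < length (w j). x (p j + int i) = w j ! i)"
    using assms unfolding concatenation_def by blast
  then have wp: "w j \<in> wrap k ` code k" "p (j + 1) = p j + int (length (w j))"
      "i < length (w j) \<Longrightarrow> x (p j + int i) = w j ! i" for i j
    by auto
  have len: "length (w j) \<ge> 1" for j
    using wp(1)[of j] wrap_not_Nil by (metis One_nat_def Suc_leI imageE length_greater_0_conv)
  \<comment> \<open>Blocks are nonempty, so the cut points advance by at least one per
    block.\<close>
  have grow: "p (j + int t) \<ge> p j + int t" for j t
  proof (induction t)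
    case (Suc t)
    have "p (j + int (Suc t)) = p (j + int t) + int (length (w (j + int t)))"
      using wp(2)[of "j + int t"] by (simp add: algebra_simps)
    with Suc len[of "j + int t"] show ?case by simp
  qed simp
  have blocks: "window x (p j) (nat (p (j + int t) - p j)) \<in> code k" for j t
  proof (induction t)
    case 0
    then show ?case by (simp add: window_def code.Nil)
  next
    case (Suc t)
    let ?j = "j + int t"
    have "p (j + int (Suc t)) = p ?j + int (length (w ?j))"
      using wp(2)[of ?j] by (simp add: algebra_simps)
    then have "nat (p (j + int (Suc t)) - p j) = nat (p ?j - p j) + length (w ?j)"
      using grow[of j t] by simp
    moreover have "window x (p ?j) (length (w ?j)) = w ?j"
      using wp(3) by (intro window_eqI) auto
    moreover have "w ?j \<in> code k" using wp(1)[of ?j] wrap_in_code by auto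
    ultimately show ?case
      using Suc grow[of j t] by (simp add: window_append code_append)
  qed
  \<comment> \<open>At least \<open>s\<close> positions lie between \<open>p (- s)\<close> and
    \<open>p 0\<close>, and at least \<open>s + n\<close> between \<open>p 0\<close> and
    \<open>p (s + n)\<close>; hence these blocks cover the window.\<close>
  define s where "s = nat \<bar>a - p 0\<bar>"
  define j where "j = - int s"
  define t where "t = s + s + n"
  have "p j \<le> a" using grow[of j s] unfolding j_def s_def by simp
  moreover have "p (j + int t) \<ge> a + int n"
    using grow[of 0 "s + n"] unfolding j_def t_def s_def by simp
  ultimately have "sublist (window x a n) (window x (p j) (nat (p (j + int t) - p j)))"
    by (intro sublist_window) auto
  with blocks[of j t] show ?thesis by (auto simp: lang_def)
qed

lemma concatenation_repeat:
  assumes "w \<in> W" "w \<noteq> []"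
  shows "concatenation W (\<lambda>i. w ! nat ((i + t) mod int (length w)))"
  unfolding concatenation_def
  using assms
  by (intro exI[of _ "\<lambda>_. w"] exI[of _ "\<lambda>j. j * int (length w) - t"])
     (auto simp: algebra_simps)

text \<open>A code word may be empty or a product of wraps, but its own wrap is a nonempty generator
  word containing it, and can be repeated periodically.\<close>

lemma lang_extends_to_concatenation:
  assumes "v \<in> lang k"
  obtains y where "concatenation (wrap k ` code k) y" "window y a (length v) = v"
proof -
  obtain c where c: "c \<in> code k" "sublist v c" using assms by (auto simp: lang_def)
  then have "sublist v (wrap k c)"
    unfolding wrap_def sublist_append by blast
  then obtain p s where w: "wrap k c = p @ v @ s" by (auto simp: sublist_def)
  let ?w = "wrap k c"
  \<comment> \<open>The offset puts the chosen occurrence of \<open>v\<close> at position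
    \<open>a\<close>.\<close>
  let ?y = "\<lambda>i. ?w ! nat ((i + (int (length p) - a)) mod int (length ?w))"
  have "concatenation (wrap k ` code k) ?y"
    using concatenation_repeat c(1) wrap_not_Nil by blast
  moreover have "window ?y a (length v) = v"
  proof (rule window_eqI)
    fix i assume i: "i < length v"
    have "nat ((a + int i + (int (length p) - a)) mod int (length ?w)) = length p + i"
      using i by (simp add: w)
    then show "?y (a + int i) = v ! i" using i by (simp add: w nth_append)
  qed simp
  ultimately show ?thesis by (rule that)
qed

section \<open>Topology of the full shift and the coded system\<close>

lemma topspace_full_shift: "topspace (full_shift A) = {x. \<forall>i. x i \<in> A}"
  by (auto simp: full_shift_def PiE_def Pi_def)

text \<open>A basic open set restricts finitely many coordinates. Allowing every larger
  \<open>N'\<close> lets two open sets share one window size.\<close>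

lemma full_shift_open_window:
  assumes "openin (full_shift A) T" "x \<in> T"
  shows "\<exists>N. \<forall>N' \<ge> N. \<forall>y. (\<forall>i. y i \<in> A) \<longrightarrow>
      window y (- int N') (2 * N' + 1) = window x (- int N') (2 * N' + 1) \<longrightarrow> y \<in> T"
proof -
  obtain U where U: "finite {i. U i \<noteq> A}" "x \<in> Pi\<^sub>E UNIV U" "Pi\<^sub>E UNIV U \<subseteq> T"
    using assms unfolding full_shift_def openin_product_topology_alt by force
  obtain N where N: "\<And>i. U i \<noteq> A \<Longrightarrow> nat \<bar>i\<bar> \<le> N"
    using finite_nat_set_iff_bounded_le[of "(\<lambda>i. nat \<bar>i\<bar>) ` {i. U i \<noteq> A}"] U(1) by auto
  show ?thesis
  proof (intro exI allI impI)
    fix N' y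
    assume y: "N' \<ge> N" "\<forall>i. y i \<in> A"
      and win: "window y (- int N') (2 * N' + 1) = window x (- int N') (2 * N' + 1)"
    have "y i \<in> U i" for i
    proof (cases "U i = A")
      case False
      then have "nat (i + int N') < 2 * N' + 1" "int (nat (i + int N')) = i + int N'"
        using N[of i] y(1) by auto
      then have "y i = x i"
        using arg_cong[OF win, of "\<lambda>v. v ! nat (i + int N')"] by simp
      then show ?thesis using U(2) by auto
    qed (use y in auto)
    then show "y \<in> T" using U(3) by auto
  qed
qed

lemma openin_window_eq:
  "openin (full_shift A) {y \<in> topspace (full_shift A). window y a n = v}"
proof -
  have "openin (full_shift A) {y \<in> topspace (full_shift A). y i = b}" for i b
  proof -
    have "openin (full_shift A) {y \<in> topspace (full_shift A). y i \<in> A \<inter> {b}}"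
      unfolding full_shift_def
      by (rule openin_continuous_map_preimage[OF continuous_map_product_projection]) auto
    also have "{y \<in> topspace (full_shift A). y i \<in> A \<inter> {b}} = {y \<in> topspace (full_shift A). y i = b}"
      by (auto simp: topspace_full_shift)
    finally show ?thesis .
  qed
  \<comment> \<open>The extra \<open>topspace\<close> covers \<open>n = 0\<close>, where the empty
    intersection is everything.\<close>
  then have "openin (full_shift A) ((\<Inter>i\<in>{..<n}. {y \<in> topspace (full_shift A). y (a + int i) = v ! i})
      \<inter> topspace (full_shift A))"
    by (intro openin_INT) auto
  also have "\<dots> = {y \<in> topspace (full_shift A). \<forall>i\<in>{..<n}. y (a + int i) = v ! i}"
    by auto
  finally have "openin (full_shift A) {y \<in> topspace (full_shift A). \<forall>i\<in>{..<n}. y (a + int i) = v ! i}" .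
  moreover have "window y a n = v \<longleftrightarrow> length v = n \<and> (\<forall>i\<in>{..<n}. y (a + int i) = v ! i)" for y
    by (auto simp: list_eq_iff_nth_eq)
  ultimately show ?thesis by (cases "length v = n") auto
qed

text \<open>Cylinders are neighbourhoods, so each window of a limit point is a window of a
  concatenation; conversely each central window of a point of the shift extends to a
  concatenation.\<close>

lemma closure_eq_ramp_shift:
  assumes "k > 0"
  shows "full_shift {0..<k} closure_of {x. concatenation (wrap k ` code k) x} = ramp_shift k"
proof (intro equalityI subsetI)
  fix x assume x: "x \<in> full_shift {0..<k} closure_of {x. concatenation (wrap k ` code k) x}"
  show "x \<in> ramp_shift k" unfolding ramp_shift_def
  proof safe
    fix a n
    let ?T = "{y \<in> topspace (full_shift {0..<k}). window y a n = window x a n}"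
    have "x \<in> ?T" using subsetD[OF closure_of_subset_topspace x] by simp
    then have "\<exists>y. y \<in> {x. concatenation (wrap k ` code k) x} \<and> y \<in> ?T"
      using x[unfolded in_closure_of, THEN conjunct2, THEN spec[of _ ?T]] openin_window_eq by (elim mp, intro conjI)
    then obtain y where "concatenation (wrap k ` code k) y" "y \<in> ?T" by (elim exE conjE) simp
    then show "window x a n \<in> lang k" using window_concatenation_in_lang[of k y a n] by simp
  qed
next
  fix x assume x: "x \<in> ramp_shift k"
  show "x \<in> full_shift {0..<k} closure_of {x. concatenation (wrap k ` code k) x}"
    unfolding in_closure_of
  proof (intro conjI allI impI)
    show "x \<in> topspace (full_shift {0..<k})"
      using ramp_shift_in_alphabet[OF x assms] by (simp add: topspace_full_shift)
  next
    fix T assume T: "x \<in> T \<and> openin (full_shift {0..<k}) T"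
    then obtain N where N: "\<forall>N' \<ge> N. \<forall>y. (\<forall>i. y i \<in> {0..<k}) \<longrightarrow>
      window y (- int N') (2 * N' + 1) = window x (- int N') (2 * N' + 1) \<longrightarrow> y \<in> T"
      using full_shift_open_window by blast
    have "window x (- int N) (2 * N + 1) \<in> lang k" using x by (simp add: ramp_shift_def)
    from lang_extends_to_concatenation[OF this, of "- int N"]
    obtain y where y: "concatenation (wrap k ` code k) y"
        "window y (- int N) (2 * N + 1) = window x (- int N) (2 * N + 1)"
      unfolding length_window by blast
    have "y \<in> ramp_shift k" unfolding ramp_shift_def using window_concatenation_in_lang[OF y(1)] by blast
    then have "y \<in> T" using N y(2) ramp_shift_in_alphabet assms by blast
    with y(1) show "\<exists>y. y \<in> {x. concatenation (wrap k ` code k) x} \<and> y \<in> T" by blast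
  qed
qed

lemma lang_extends_to_ramp_shift:
  assumes "v \<in> lang k"
  obtains y where "y \<in> ramp_shift k" "window y a (length v) = v"
proof -
  obtain y where y: "concatenation (wrap k ` code k) y" "window y a (length v) = v"
    using lang_extends_to_concatenation[OF assms] by blast
  have "y \<in> ramp_shift k"
    unfolding ramp_shift_def using window_concatenation_in_lang[OF y(1)] by blast
  from that[OF this y(2)] show thesis .
qed

lemma window_shift_pow: "window (shift_pow n x) a m = window x (a + n) m"
  by (simp add: window_def shift_pow_def algebra_simps)

lemma shift_pow_ramp_shift: "x \<in> ramp_shift k \<Longrightarrow> shift_pow n x \<in> ramp_shift k"
  by (simp add: ramp_shift_def window_shift_pow)

lemma subshift_ramp_shift:
  assumes "k > 0" shows "subshift {0..<k} (ramp_shift k)"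
  unfolding subshift_def
proof (intro conjI)
  have "[] \<in> lang k" by (auto simp: lang_def intro: code.Nil)
  then show "ramp_shift k \<noteq> {}" using lang_extends_to_ramp_shift by blast
  show "closedin (full_shift {0..<k}) (ramp_shift k)"
    using closure_eq_ramp_shift[OF assms] closedin_closure_of by metis
  have "x \<in> shift ` ramp_shift k" if "x \<in> ramp_shift k" for x
    using shift_pow_ramp_shift[OF that, of "-1"] shift_pow_add[of 1 "-1"] shift_pow_0
    by (metis add.right_inverse comp_apply id_apply image_eqI)
  then show "shift ` ramp_shift k = ramp_shift k" using shift_pow_ramp_shift by blast
qed simp

lemma generator_ramp_shift: "k > 0 \<Longrightarrow> generator {0..<k} (ramp_shift k) (wrap k ` code k)"
  unfolding generator_def
proof (intro conjI)
  assume k: "k > 0"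
  show "countable (wrap k ` code k)" by simp
  show "wrap k ` code k \<subseteq> lists {0..<k}"
    using code_in_lists[OF wrap_in_code k] by blast
  show "[] \<notin> wrap k ` code k" using wrap_not_Nil by (metis imageE)
  show "ramp_shift k = full_shift {0..<k} closure_of {x. concatenation (wrap k ` code k) x}"
    using closure_eq_ramp_shift[OF k] ..
qed

section \<open>Mixing\<close>

text \<open>Each further wrap puts \<open>k * l + 1\<close> letters in front, which shifts the start
  of \<open>v\<close> by one modulo \<open>k\<close>.\<close>

lemma code_every_phase:
  assumes "p @ v @ s \<in> code k" "k > 0"
  shows "\<exists>p' s'. p' @ v @ s' \<in> code k \<and> length p' mod k = (length p + r) mod k"
proof (induction r)
  case 0
  then show ?case using assms(1) by auto
next
  case (Suc r)
  then obtain p' s' where p': "p' @ v @ s' \<in> code k" "length p' mod k = (length p + r) mod k"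
    by blast
  define l where "l = length (p' @ v @ s')"
  have "(ramp k 0 (k * l + 1) @ p') @ v @ (s' @ ramp k 1 (k * (l + 1))) \<in> code k"
    using wrap_in_code[OF p'(1)] unfolding wrap_def l_def by (simp only: append_assoc)
  moreover have "length (ramp k 0 (k * l + 1) @ p') mod k = (length p + Suc r) mod k"
  proof -
    have "length (ramp k 0 (k * l + 1) @ p') = Suc (length p') + l * k" by (simp add: mult.commute)
    then have "length (ramp k 0 (k * l + 1) @ p') mod k = Suc (length p') mod k"
      by (simp only: mod_mult_self1)
    also have "\<dots> = Suc (length p + r) mod k" using p'(2) by (metis mod_Suc_eq)
    finally show ?thesis by simp
  qed
  ultimately show ?case by blast
qed

lemma code_word_of_length:
  assumes "k > 0" obtains d where "d \<in> code k" "length d = k * q"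
proof -
  have "\<exists>d \<in> code k. length d = k * q"
  proof (induction q)
    case 0
    then show ?case using code.Nil by force
  next
    case (Suc q)
    then obtain d where "d \<in> code k" "length d = k * q" by blast
    then show ?case
      using code.Wrap[OF code.Nil, of d k] wrap_Nil[OF assms] by (intro bexI[of _ "wrap k [] @ d"]) auto
  qed
  with that show ?thesis by blast
qed

text \<open>The gap consists of the rest \<open>s1\<close> of the code word around \<open>u\<close>,
  a filler of length divisible by \<open>k\<close>, and a lead-in \<open>P r\<close> to
  \<open>v\<close> whose length has the right residue.\<close>

lemma lang_gaps:
  assumes "u \<in> lang k" "v \<in> lang k" "k > 0"
  shows "\<exists>G. \<forall>g \<ge> G. \<exists>t. length t = g \<and> u @ t @ v \<in> lang k"
proof -
  obtain p1 s1 where u: "p1 @ u @ s1 \<in> code k" using assms(1) by (auto simp: lang_def sublist_def)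
  obtain p2 s2 where v: "p2 @ v @ s2 \<in> code k" using assms(2) by (auto simp: lang_def sublist_def)
  obtain P Q where PQ: "\<And>r. P r @ v @ Q r \<in> code k" "\<And>r. length (P r) mod k = (length p2 + r) mod k"
    using code_every_phase[OF v assms(3)] by metis
  \<comment> \<open>One bound for the lead-ins of all \<open>k\<close> phases.\<close>
  define M where "M = (\<Sum>r<k. length (P r))"
  show ?thesis
  proof (intro exI[of _ "length s1 + M"] allI impI)
    fix g assume g: "g \<ge> length s1 + M"
    \<comment> \<open>Solves \<open>length p2 + r = g - length s1\<close> modulo \<open>k\<close>,
      with \<open>k - length p2 mod k\<close> standing for the negative of
      \<open>length p2\<close>.\<close>
    define r where "r = (g - length s1 + (k - length p2 mod k)) mod k"
    have "r < k" using assms(3) by (simp add: r_def)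
    then have PM: "length (P r) \<le> M"
      unfolding M_def by (intro member_le_sum) auto
    have "(length p2 + r) mod k = (g - length s1 + (length p2 mod k + (k - length p2 mod k))) mod k"
      unfolding r_def by (metis (no_types, opaque_lifting) add.left_commute mod_add_left_eq mod_add_right_eq)
    also have "\<dots> = (g - length s1) mod k" using assms(3) by simp
    finally have "k dvd (g - length s1) - length (P r)"
      using PQ(2)[of r] PM g
      by (subst mod_eq_dvd_iff_nat[symmetric]) auto
    then obtain q where q: "g - length s1 - length (P r) = k * q" by blast
    obtain d where d: "d \<in> code k" "length d = k * q"
      using code_word_of_length[OF assms(3)] by blast
    have "(p1 @ u @ s1) @ d @ P r @ v @ Q r \<in> code k"
      by (rule code_append[OF u code_append[OF d(1) PQ(1)]])
    then have "p1 @ (u @ (s1 @ d @ P r) @ v) @ Q r \<in> code k" by simp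
    then have "u @ (s1 @ d @ P r) @ v \<in> lang k"
      unfolding lang_def by (blast intro: sublist_appendI)
    moreover have "length (s1 @ d @ P r) = g" using q d(2) PM g by simp
    ultimately show "\<exists>t. length t = g \<and> u @ t @ v \<in> lang k" by blast
  qed
qed

lemma ramp_shift_gaps:
  assumes "x \<in> ramp_shift k" "y \<in> ramp_shift k" "k > 0"
  shows "\<exists>G. \<forall>n \<ge> G. \<exists>z \<in> ramp_shift k. window z a q = window x a q \<and> window z (a + int n) q = window y a q"
proof -
  have "window x a q \<in> lang k" "window y a q \<in> lang k" using assms by (auto simp: ramp_shift_def)
  then obtain G where G: "\<And>g. g \<ge> G \<Longrightarrow> \<exists>t. length t = g \<and> window x a q @ t @ window y a q \<in> lang k"
    using lang_gaps assms(3) by metis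
  show ?thesis
  proof (intro exI allI impI)
    \<comment> \<open>The distance \<open>n\<close> is between the starts of the windows, so the gap
      is \<open>n - q\<close>.\<close>
    fix n assume n: "n \<ge> G + q"
    then obtain t where t: "length t = n - q" "window x a q @ t @ window y a q \<in> lang k"
      using G[of "n - q"] by (metis add_le_imp_le_diff)
    from lang_extends_to_ramp_shift[OF t(2), of a]
    obtain z where z: "z \<in> ramp_shift k" "window z a (q + ((n - q) + q)) = window x a q @ t @ window y a q"
      using t(1) by auto
    then have "window z a q = window x a q" "window z (a + int n) q = window y a q"
      using t(1) n unfolding window_append by (auto simp: of_nat_diff)
    with z(1) show "\<exists>z \<in> ramp_shift k. window z a q = window x a q \<and> window z (a + int n) q = window y a q"
      by blast
  qed
qed

lemma mixing_ramp_shift: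
  assumes "k > 0" shows "mixing {0..<k} (ramp_shift k)"
  unfolding mixing_def
proof (intro allI impI, elim conjE)
  fix U V
  let ?F = "full_shift {0..<k}"
  assume U: "openin (subtopology ?F (ramp_shift k)) U" "U \<noteq> {}" and V: "openin (subtopology ?F (ramp_shift k)) V" "V \<noteq> {}"
  obtain TU where TU: "openin ?F TU" "U = TU \<inter> ramp_shift k" using U(1) by (auto simp: openin_subtopology)
  obtain TV where TV: "openin ?F TV" "V = TV \<inter> ramp_shift k" using V(1) by (auto simp: openin_subtopology)
  obtain x y where x: "x \<in> TU" "x \<in> ramp_shift k" and y: "y \<in> TV" "y \<in> ramp_shift k" using U(2) V(2) TU TV by auto
  obtain N1 where N1: "\<forall>N' \<ge> N1. \<forall>z. (\<forall>i. z i \<in> {0..<k}) \<longrightarrow>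
      window z (- int N') (2 * N' + 1) = window x (- int N') (2 * N' + 1) \<longrightarrow> z \<in> TU"
    using full_shift_open_window[OF TU(1) x(1)] by blast
  obtain N2 where N2: "\<forall>N' \<ge> N2. \<forall>z. (\<forall>i. z i \<in> {0..<k}) \<longrightarrow>
      window z (- int N') (2 * N' + 1) = window y (- int N') (2 * N' + 1) \<longrightarrow> z \<in> TV"
    using full_shift_open_window[OF TV(1) y(1)] by blast
  define N where "N = max N1 N2"
  let ?a = "- int N" and ?q = "2 * N + 1"
  have inU: "z \<in> U" if "z \<in> ramp_shift k" "window z ?a ?q = window x ?a ?q" for z
    using N1[rule_format, of N z] ramp_shift_in_alphabet[OF that(1) assms] that TU(2) by (auto simp: N_def)
  have inV: "z \<in> V" if "z \<in> ramp_shift k" "window z ?a ?q = window y ?a ?q" for z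
    using N2[rule_format, of N z] ramp_shift_in_alphabet[OF that(1) assms] that TV(2) by (auto simp: N_def)
  \<comment> \<open>Hitting times range over all integers: positive ones need \<open>x\<close>
    before \<open>y\<close>, negative ones \<open>y\<close> before \<open>x\<close>.\<close>
  obtain G1 where G1: "\<And>n. n \<ge> G1 \<Longrightarrow> \<exists>z \<in> ramp_shift k. window z ?a ?q = window x ?a ?q \<and> window z (?a + int n) ?q = window y ?a ?q"
    using ramp_shift_gaps[OF x(2) y(2) assms] by metis
  obtain G2 where G2: "\<And>n. n \<ge> G2 \<Longrightarrow> \<exists>z \<in> ramp_shift k. window z ?a ?q = window y ?a ?q \<and> window z (?a + int n) ?q = window x ?a ?q"
    using ramp_shift_gaps[OF y(2) x(2) assms] by metis
  have "n \<in> hitting_times U V" if n: "n \<ge> int G1 \<or> n \<le> - int G2" for n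
  proof (cases "n \<ge> int G1")
    case True
    then have "nat n \<ge> G1" "int (nat n) = n" by auto
    then obtain z where "z \<in> ramp_shift k" "window z ?a ?q = window x ?a ?q" "window z (?a + n) ?q = window y ?a ?q"
      using G1[of "nat n"] by metis
    then have "z \<in> U" "shift_pow n z \<in> V"
      using inU inV shift_pow_ramp_shift by (auto simp: window_shift_pow)
    then show ?thesis by (auto simp: hitting_times_def)
  next
    case False
    then have "nat (- n) \<ge> G2" "?a + int (nat (- n)) = ?a - n" using n by auto
    then obtain z where "z \<in> ramp_shift k" "window z ?a ?q = window y ?a ?q" "window z (?a - n) ?q = window x ?a ?q"
      using G2[of "nat (- n)"] by metis
    \<comment> \<open>Here \<open>z\<close> itself lies in \<open>V\<close>, so the point of
      \<open>U\<close> is its shift by \<open>- n\<close>.\<close>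
    then have "shift_pow (- n) z \<in> U" "shift_pow n (shift_pow (- n) z) \<in> V"
      using inU inV shift_pow_ramp_shift by (auto simp: window_shift_pow)
    then show ?thesis by (auto simp: hitting_times_def)
  qed
  then have "\<not> (n \<ge> int G1 \<or> n \<le> - int G2)" if "n \<in> - hitting_times U V" for n
    using that by blast
  then have "- hitting_times U V \<subseteq> {- int G2..int G1}" by fastforce
  then show "finite (- hitting_times U V)" by (rule finite_subset) simp
qed

section \<open>Periodic points and lengths of generator words\<close>

lemma dvd_period:
  assumes "k \<ge> 2" "x \<in> ramp_shift k" "\<And>i. x (i + int m) = x i"
  shows "k dvd m"
proof (rule ccontr)
  assume ndvd: "\<not> k dvd m"
  let ?f = "weight k (window x 0 m)"
  have win: "window x (int (N * m)) m = window x 0 m" for N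
  proof -
    have "x (int (N * m) + i) = x i" for i
    proof (induction N)
      case (Suc N)
      have "x (int (Suc N * m) + i) = x ((int (N * m) + i) + int m)" by (simp add: algebra_simps)
      then show ?case using assms(3) Suc by metis
    qed simp
    then show ?thesis by (simp add: window_def)
  qed
  have sum: "weight k (window x 0 (N * m)) = int N * ?f" for N
  proof (induction N)
    case 0
    then show ?case by (simp add: window_def weight_def)
  next
    case (Suc N)
    have "window x 0 (Suc N * m) = window x 0 (N * m) @ window x 0 m"
      using window_append[of x 0 "N * m" m] win[of N] by (simp add: add.commute)
    with Suc show ?case by (simp add: weight_append algebra_simps)
  qed
  have "\<bar>int N * ?f\<bar> \<le> 2 * bound k m" for N
  proof -
    have "periodic m (window x 0 (N * m))"
      using assms(3) by (auto simp: periodic_def)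
    moreover have "window x 0 (N * m) \<in> lang k" using assms(2) by (simp add: ramp_shift_def)
    ultimately show ?thesis
      using weight_periodic_lang[OF assms(1) ndvd] sum[of N] by metis
  qed
  \<comment> \<open>This many periods would exceed the bound if one period had nonzero integer
    weight.\<close>
  note le = this[of "nat (2 * bound k m) + 1"]
  have "?f = 0"
  proof (rule ccontr)
    assume "?f \<noteq> 0"
    then have "int (nat (2 * bound k m) + 1) * 1 \<le> int (nat (2 * bound k m) + 1) * \<bar>?f\<bar>"
      by (intro mult_left_mono) auto
    then have "int (nat (2 * bound k m) + 1) \<le> 2 * bound k m"
      using le by (simp only: abs_mult abs_of_nat mult_1_right)
    then show False by (simp split: if_splits)
  qed
  then have "int m = int (k * count_list (window x 0 m) 0)" by (simp add: weight_def)
  then have "k dvd m" by (metis dvd_triv_left of_nat_eq_iff)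
  with ndvd show False ..
qed

text \<open>Whatever the generator, repeating \<open>w\<close> forever gives a point of the shift
  with period \<open>length w\<close>.\<close>

lemma dvd_length_generator:
  assumes "k \<ge> 2" "generator {0..<k} (ramp_shift k) W" "w \<in> W"
  shows "k dvd length w"
proof (rule dvd_period[OF assms(1)])
  let ?x = "\<lambda>i. w ! nat ((i + 0) mod int (length w))"
  have w: "w \<noteq> []" "w \<in> lists {0..<k}" using assms(2,3) by (auto simp: generator_def)
  have "?x i \<in> {0..<k}" for i
  proof -
    have "nat ((i + 0) mod int (length w)) < length w"
      using w(1) by (simp add: nat_less_iff)
    then have "?x i \<in> set w" by (rule nth_mem)
    with w(2) show ?thesis by auto
  qed
  then have "?x \<in> topspace (full_shift {0..<k}) \<inter> {x. concatenation W x}"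
    using concatenation_repeat[OF assms(3) w(1), of 0] by (simp add: topspace_full_shift)
  then have "?x \<in> full_shift {0..<k} closure_of {x. concatenation W x}"
    by (rule subsetD[OF closure_of_subset_Int])
  then show "?x \<in> ramp_shift k" using assms(2) by (simp only: generator_def)
  show "?x (i + int (length w)) = ?x i" for i by simp
qed

theorem theorem4p1:
  fixes k :: nat
  assumes "k \<ge> 2"
  shows "\<exists>(A :: nat set) (S :: (int \<Rightarrow> nat) set).
           coded_system A S \<and> mixing A S \<and>
           (\<forall>W. generator A S W \<longrightarrow> Gcd (length ` W) \<ge> k)"
proof (intro exI conjI allI impI)
  have k: "k > 0" using assms by simp
  show "coded_system {0..<k} (ramp_shift k)"
    using subshift_ramp_shift[OF k] generator_ramp_shift[OF k] by (auto simp: coded_system_def)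
  show "mixing {0..<k} (ramp_shift k)" by (rule mixing_ramp_shift[OF k])
  fix W assume W: "generator {0..<k} (ramp_shift k) W"
  \<comment> \<open>Divisibility by \<open>k\<close> gives the inequality only for a nonzero
    \<open>Gcd\<close>, hence the need for a nonempty word in \<open>W\<close>.\<close>
  have "W \<noteq> {}"
  proof
    assume "W = {}"
    then have "ramp_shift k = {}" using W by (simp add: generator_def concatenation_def)
    with subshift_ramp_shift[OF k] show False by (simp add: subshift_def)
  qed
  then obtain w where w: "w \<in> W" "w \<noteq> []" using W by (auto simp: generator_def)
  have "k dvd Gcd (length ` W)"
    using dvd_length_generator[OF assms W] by (auto intro: Gcd_greatest)
  moreover have "Gcd (length ` W) dvd length w" using w(1) by simp
  then have "Gcd (length ` W) \<noteq> 0" using w(2) by (metis dvd_0_left length_0_conv)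
  ultimately show "Gcd (length ` W) \<ge> k" by (meson dvd_imp_le gr0I)
qed

end
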